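(* Let $f,g\in\mathbb{C}\{x,y\}$ with $f(0)=g(0)=0$ be convenient. Orient the Newton diagram of $f$ from the $y$-axis to the $x$-axis and let its edge vectors, in that order, be $e_k=(p_k,-q_k)$ with $p_k,q_k>0$, $k=1,\dots,r$; similarly let the edge vectors of the Newton diagram of $g$ be $e_i'=(p_i',-q_i')$ with $p_i',q_i'>0$, $i=1,\dots,s$. Then $$\operatorname{Covol}\bigl(\Gamma_+(f),\Gamma_+(g)\bigr)=\sum_{k=1}^{r}\sum_{i=1}^{s}\min\bigl(p_kq_i',\;p_i'q_k\bigr).$$
   Context: For $f\in\mathbb{C}\{x,y\}$ (convergent power series) with $f(0)=0$, the Newton polyhedron is $\Gamma_+(f)=\operatorname{conv}\bigl(\bigcup_{\alpha\in\operatorname{supp}f}(\alpha+\mathbb{R}^2_{\ge0})\bigr)$, where $\operatorname{supp}f\subset\mathbb{Z}_{\ge0}^2$ is the set of exponents of monomials with nonzero coefficient. The Newton diagram of $f$ is the union of the compact faces of $\Gamma_+(f)$. The series $f$ is convenient if its Newton diagram meets both coordinate axes. For convenient $f$, $\operatorname{covol}\Gamma_+(f)=\operatorname{area}(\mathbb{R}^2_{\ge0}\setminus\Gamma_+(f))<\infty$, and $\operatorname{covol}$ of a Minkowski sum of such polyhedra is defined by the same formula. The mixed covolume is $$\operatorname{Covol}(\Gamma_+(f),\Gamma_+(g))=\operatorname{covol}(\Gamma_+(f)+\Gamma_+(g))-\operatorname{covol}\Gamma_+(f)-\operatorname{covol}\Gamma_+(g),$$ where $+$ is the Minkowski sum.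 *)

theory Defs
  imports "HOL-Analysis.Analysis" "HOL-Computational_Algebra.Formal_Power_Series"
begin

text \<open>
  Bivariate power series are elements of \<open>\<complex>[[x]][[y]]\<close>: the outer variable is \<open>y\<close>, the
  inner one is \<open>x\<close>, so that \<open>coeff2 f i j\<close> is the coefficient of \<open>x\<^sup>i y\<^sup>j\<close>.
\<close>

type_synonym fps2 = "complex fps fps"

definition coeff2 :: "fps2 \<Rightarrow> nat \<Rightarrow> nat \<Rightarrow> complex" where
  "coeff2 f i j = fps_nth (fps_nth f j) i"

text \<open>Membership in \<open>\<complex>{x,y}\<close>: absolute convergence on some polydisc around the origin.\<close>

definition convergent_fps2 :: "fps2 \<Rightarrow> bool" where
  "convergent_fps2 f \<longleftrightarrow>
     (\<exists>\<rho>>0. (\<lambda>(i, j). norm (coeff2 f i j) * \<rho> ^ (i + j)) summable_on (UNIV :: (nat \<times> nat) set))"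

definition supp2 :: "fps2 \<Rightarrow> (nat \<times> nat) set" where
  "supp2 f = {(i, j). coeff2 f i j \<noteq> 0}"

definition quadrant :: "(real \<times> real) set" where
  "quadrant = {(x, y). x \<ge> 0 \<and> y \<ge> 0}"

definition newton_polyhedron :: "fps2 \<Rightarrow> (real \<times> real) set" where
  "newton_polyhedron f =
     convex hull (\<Union>(i, j) \<in> supp2 f. (\<lambda>z. (real i, real j) + z) ` quadrant)"

definition newton_diagram :: "fps2 \<Rightarrow> (real \<times> real) set" where
  "newton_diagram f = \<Union>{F. F face_of newton_polyhedron f \<and> compact F}"

definition convenient :: "fps2 \<Rightarrow> bool" where
  "convenient f \<longleftrightarrow>
     (\<exists>z \<in> newton_diagram f. fst z = 0) \<and> (\<exists>z \<in> newton_diagram f. snd z = 0)"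

text \<open>
  \<open>newton_edge_vectors f r e\<close>: the edge vectors of the Newton diagram of \<open>f\<close>, oriented from the
  \<open>y\<close>-axis to the \<open>x\<close>-axis, are \<open>e 1, \<dots>, e r\<close> in this order. Here \<open>v 0, \<dots>, v r\<close> are the
  successive vertices of the diagram, starting on the \<open>y\<close>-axis and ending on the \<open>x\<close>-axis, and
  each compact edge of the Newton polyhedron is traversed exactly once.
\<close>

definition newton_edge_vectors :: "fps2 \<Rightarrow> nat \<Rightarrow> (nat \<Rightarrow> real \<times> real) \<Rightarrow> bool" where
  "newton_edge_vectors f r e \<longleftrightarrow>
     (\<exists>v :: nat \<Rightarrow> real \<times> real.
        fst (v 0) = 0 \<and> snd (v r) = 0 \<and>
        bij_betw (\<lambda>k. closed_segment (v (k - 1)) (v k)) {1..r}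
          {E. E edge_of newton_polyhedron f \<and> compact E} \<and>
        (\<forall>k \<in> {1..r}. e k = v k - v (k - 1)))"

text \<open>
  Only meaningful when \<open>quadrant - P\<close> has finite area (as for convenient series), since
  \<^const>\<open>measure\<close> sends infinite area to 0.
\<close>

definition covol :: "(real \<times> real) set \<Rightarrow> real" where
  "covol P = measure lebesgue (quadrant - P)"

text \<open>The \<open>+\<close> of sets is the Minkowski sum.\<close>

definition mixed_covol :: "(real \<times> real) set \<Rightarrow> (real \<times> real) set \<Rightarrow> real" where
  "mixed_covol P Q = covol (P + Q) - covol P - covol Q"

end

theory Submission
  imports Defs
begin

text \<open>
  The covolume of a convex region of this kind is a quadratic form in the edges of its diagram, and the
  mixed covolume is the associated bilinear form.

  For one edge \<open>(p, -q)\<close> let the corner be the set of points of the quadrant on or above the segment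
  from \<open>(0, q)\<close> to \<open>(p, 0)\<close>. The Newton polyhedron of a convenient series is the Minkowski sum of the
  corners of its edges (\<open>newton_polyhedron_eq_corner_sum\<close>): the edges are supporting segments, so the
  polyhedron is the region above a convex chain, and such a chain is assembled from its edges by
  Minkowski addition. Hence the sum of two Newton polyhedra is the sum of the corners of all edges
  of both.

  For a sum of corners, arrange the edges in the order of decreasing steepness. The region below the chain
  then decomposes into the triangle of area \<open>p k * q k / 2\<close> under each edge and, for \<open>k\<close> before \<open>l\<close>, a
  rectangle of area \<open>p k * q l\<close>, below edge \<open>k\<close> and as high as edge \<open>l\<close>. As edge \<open>k\<close> is the steeper one, this
  product is \<open>min (p k * q l) (p l * q k)\<close>, an expression that no longer refers to the order.
  Therefore the covolume is half of the sum of these minima over all ordered pairs of edges, with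
  the triangles as the diagonal terms (\<open>covol_corner_sum\<close>). Subtracting the pairs within each of
  the two diagrams leaves the mixed pairs (\<open>mixed_covol_corner_sums\<close>).
\<close>

section \<open>The region under a sum of corners\<close>

text \<open>
  For \<open>p, q > 0\<close>, a polyhedron whose only compact edge runs from \<open>(0, q)\<close> to \<open>(p, 0)\<close>.
\<close>

definition corner :: "real \<Rightarrow> real \<Rightarrow> (real \<times> real) set" where
  "corner p q = {(x, y). 0 \<le> x \<and> 0 \<le> y \<and> p * q \<le> q * x + p * y}"

definition epigraph_over_ray :: "(real \<Rightarrow> real) \<Rightarrow> (real \<times> real) set" where
  "epigraph_over_ray \<phi> = {(x, y). 0 \<le> x \<and> \<phi> x \<le> y}"

text \<open>
  The contribution of one edge \<open>(p, -q)\<close>, starting at abscissa \<open>a\<close>, to the height of a descending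
  chain of edges: it is \<open>q\<close> before the edge, falls linearly to \<open>0\<close> along it, and stays there.
\<close>

definition ramp :: "real \<Rightarrow> real \<Rightarrow> real \<Rightarrow> real \<Rightarrow> real" where
  "ramp a p q x = max 0 (min q (q - q / p * (x - a)))"

lemma ramp_left: "0 < p \<Longrightarrow> 0 < q \<Longrightarrow> x \<le> a \<Longrightarrow> ramp a p q x = q"
  using mult_nonneg_nonpos[of "q / p" "x - a"] by (simp add: ramp_def)

lemma ramp_right: "0 < p \<Longrightarrow> 0 < q \<Longrightarrow> a \<le> x \<Longrightarrow> ramp a p q x = max 0 (q - q / p * (x - a))"
  using mult_nonneg_nonneg[of "q / p" "x - a"] by (simp add: ramp_def)

lemma ramp_edge:
  assumes "0 < p" "0 < q" "a \<le> x" "x \<le> a + p"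
  shows "ramp a p q x = q - q / p * (x - a)"
  using assms mult_left_mono[of "x - a" p "q / p"] by (simp add: ramp_right)

lemma ramp_beyond:
  assumes "0 < p" "0 < q" "a + p \<le> x"
  shows "ramp a p q x = 0"
  using assms mult_left_mono[of p "x - a" "q / p"] by (simp add: ramp_right)

lemma ramp_nonneg: "0 \<le> ramp a p q x"
  by (simp add: ramp_def)

text \<open>
  The removed region lies between the horizontal axis and the graph of \<open>\<phi>\<close>, so Fubini reduces its
  area to a one-dimensional integral.
\<close>

lemma covol_epigraph_over_ray:
  assumes [measurable]: "\<phi> \<in> borel_measurable borel"
    and nonneg: "\<And>x. 0 \<le> x \<Longrightarrow> 0 \<le> \<phi> x"
    and area: "(\<integral>\<^sup>+x. ennreal (\<phi> x) * indicator {0..} x \<partial>lborel) = ennreal c" and "0 \<le> c"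
  shows "covol (epigraph_over_ray \<phi>) = c"
proof -
  define S where "S = {z :: real \<times> real. 0 \<le> fst z \<and> 0 \<le> snd z \<and> snd z < \<phi> (fst z)}"
  have S: "quadrant - epigraph_over_ray \<phi> = S"
    by (auto simp: quadrant_def epigraph_over_ray_def S_def)
  have "{z \<in> space (borel \<Otimes>\<^sub>M borel). 0 \<le> fst z \<and> 0 \<le> snd z \<and> snd z < \<phi> (fst z)}
      \<in> sets (borel \<Otimes>\<^sub>M borel :: (real \<times> real) measure)"
    by measurable
  hence meas: "S \<in> sets (lborel \<Otimes>\<^sub>M lborel)"
    by (simp add: S_def space_pair_measure sets_pair_measure_cong[OF sets_lborel sets_lborel])
  have slice: "emeasure lborel (Pair x -` S) = ennreal (\<phi> x) * indicator {0..} x" for x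
  proof (cases "0 \<le> x")
    case True
    hence "Pair x -` S = {0..<\<phi> x}" by (auto simp: S_def)
    thus ?thesis using True nonneg[of x] by simp
  next
    case False
    hence "Pair x -` S = {}" by (auto simp: S_def)
    thus ?thesis using False by simp
  qed
  have "emeasure lborel S = emeasure (lborel \<Otimes>\<^sub>M lborel) S"
    by (simp add: lborel_prod)
  also have "\<dots> = ennreal c"
    by (simp add: lborel.emeasure_pair_measure_alt[OF meas] slice area)
  finally have "measure lborel S = c"
    using \<open>0 \<le> c\<close> by (simp add: measure_def)
  moreover have "S \<in> sets lborel"
    using meas unfolding lborel_prod .
  ultimately show ?thesis
    by (simp add: covol_def S)
qed

text \<open>
  The area consists of the rectangle of width \<open>a\<close> and height \<open>q\<close> and of the right triangle with
  legs \<open>p\<close> and \<open>q\<close> under the edge.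
\<close>

lemma nn_integral_ramp:
  assumes "0 \<le> a" "0 < p" "0 < q"
  shows "(\<integral>\<^sup>+x. ennreal (ramp a p q x) * indicator {0..} x \<partial>lborel) = ennreal (q * (a + p / 2))"
proof -
  have "(\<integral>\<^sup>+x. ennreal (ramp a p q x) * indicator {0..} x \<partial>lborel)
      = (\<integral>\<^sup>+x. ennreal q * indicator {0..<a} x
            + ennreal (q - q / p * (x - a)) * indicator {a..a + p} x \<partial>lborel)"
  proof (intro nn_integral_cong)
    fix x
    consider "x < 0" | "0 \<le> x" "x < a" | "a \<le> x" "x \<le> a + p" | "a + p < x" by linarith
    then show "ennreal (ramp a p q x) * indicator {0..} x = ennreal q * indicator {0..<a} x
            + ennreal (q - q / p * (x - a)) * indicator {a..a + p} x"
      by cases (use assms in \<open>simp_all add: ramp_left ramp_edge ramp_beyond\<close>)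
  qed
  also have "\<dots> = (\<integral>\<^sup>+x. ennreal q * indicator {0..<a} x \<partial>lborel)
     + (\<integral>\<^sup>+x. ennreal (q - q / p * (x - a)) * indicator {a..a + p} x \<partial>lborel)"
    by (intro nn_integral_add) auto
  also have "(\<integral>\<^sup>+x. ennreal q * indicator {0..<a} x \<partial>lborel) = ennreal (q * a)"
    using assms by (simp add: nn_integral_cmult_indicator ennreal_mult)
  also have "(\<integral>\<^sup>+x. ennreal (q - q / p * (x - a)) * indicator {a..a + p} x \<partial>lborel)
     = ennreal ((q * ((a + p) - a) - q / p * ((a + p) - a)\<^sup>2 / 2) - (q * (a - a) - q / p * (a - a)\<^sup>2 / 2))"
  proof (rule nn_integral_FTC_Icc[where F = "\<lambda>x. q * (x - a) - q / p * (x - a)\<^sup>2 / 2"])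
    fix x assume x: "x \<in> {a..a + p}"
    then have "q / p * (x - a) \<le> q / p * p"
      using assms by (intro mult_left_mono) auto
    then show "0 \<le> q - q / p * (x - a)" using assms by simp
    show "((\<lambda>x. q * (x - a) - q / p * (x - a)\<^sup>2 / 2) has_real_derivative q - q / p * (x - a))
      (at x)"
      using assms by (auto intro!: derivative_eq_intros simp: field_simps)
  qed (use assms in auto)
  also have "\<dots> = ennreal (q * p / 2)"
    using assms by (simp add: power2_eq_square)
  finally show ?thesis
    using assms by (simp add: ennreal_plus[symmetric] algebra_simps del: ennreal_plus)
qed

text \<open>
  Adding a corner whose edge is no steeper than any part of a descending boundary attaches this edge
  at the foot \<open>a\<close> of the boundary and lifts everything before it by \<open>q\<close>. The steepness assumption
  says that the old boundary falls at least as fast as the new edge, so in a sum \<open>z + w\<close> with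
  \<open>w\<close> in the corner it is best to exhaust the old boundary first.
\<close>

lemma epigraph_plus_corner:
  assumes "0 < p" "0 < q" "0 \<le> a"
    and nonneg: "\<And>x. 0 \<le> x \<Longrightarrow> 0 \<le> \<phi> x"
    and zero: "\<And>x. a \<le> x \<Longrightarrow> \<phi> x = 0"
    and steep: "\<And>x y. 0 \<le> x \<Longrightarrow> x \<le> y \<Longrightarrow> y \<le> a \<Longrightarrow> q / p * (y - x) \<le> \<phi> x - \<phi> y"
  shows "epigraph_over_ray \<phi> + corner p q = epigraph_over_ray (\<lambda>x. \<phi> x + ramp a p q x)"
proof (intro equalityI subsetI)
  fix z assume "z \<in> epigraph_over_ray \<phi> + corner p q"
  then obtain x1 y1 x2 y2 where z: "z = (x1 + x2, y1 + y2)"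
    and 1: "0 \<le> x1" "\<phi> x1 \<le> y1" and 2: "0 \<le> x2" "0 \<le> y2" "p * q \<le> q * x2 + p * y2"
    by (auto simp: set_plus_def epigraph_over_ray_def corner_def)
  have y2: "q - q / p * x2 \<le> y2"
    using 2(3) \<open>0 < p\<close> by (simp add: field_simps)
  have "\<phi> (x1 + x2) + ramp a p q (x1 + x2) \<le> y1 + y2"
  proof (cases "x1 + x2 \<le> a")
    case True
    have "ramp a p q (x1 + x2) = q"
      using True assms by (simp add: ramp_left)
    moreover have "q / p * x2 \<le> \<phi> x1 - \<phi> (x1 + x2)"
      using steep[of x1 "x1 + x2"] 1 2 True by simp
    ultimately show ?thesis using y2 1 by linarith
  next
    case False
    have ramp: "ramp a p q (x1 + x2) = max 0 (q - q / p * (x1 + x2 - a))"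
      using False assms by (simp add: ramp_right)
    have "q / p * (a - x1) \<le> \<phi> x1"
    proof (cases "x1 \<le> a")
      case True
      then show ?thesis using steep[of x1 a] zero[of a] 1 by simp
    next
      case False
      then have "q / p * (a - x1) \<le> 0"
        using assms by (intro mult_nonneg_nonpos) auto
      then show ?thesis using nonneg[of x1] 1 by linarith
    qed
    moreover have "q / p * (x1 + x2 - a) = q / p * x2 - q / p * (a - x1)"
      using \<open>0 < p\<close> by (simp add: field_simps)
    ultimately show ?thesis
      using ramp zero[of "x1 + x2"] False y2 1 2 nonneg[of x1] by simp
  qed
  thus "z \<in> epigraph_over_ray (\<lambda>x. \<phi> x + ramp a p q x)"
    using z 1 2 by (simp add: epigraph_over_ray_def)
next
  fix z assume "z \<in> epigraph_over_ray (\<lambda>x. \<phi> x + ramp a p q x)"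
  then obtain x y where z: "z = (x, y)" and x: "0 \<le> x" and y: "\<phi> x + ramp a p q x \<le> y"
    by (auto simp: epigraph_over_ray_def)
  show "z \<in> epigraph_over_ray \<phi> + corner p q"
  proof (cases "x \<le> a")
    case True
    have "ramp a p q x = q"
      using True assms by (simp add: ramp_left)
    then have "(x, y - q) \<in> epigraph_over_ray \<phi>" "(0, q) \<in> corner p q"
      using x y assms by (auto simp: epigraph_over_ray_def corner_def)
    then have "(x, y - q) + (0, q) \<in> epigraph_over_ray \<phi> + corner p q" by (rule set_plus_intro)
    then show ?thesis using z by simp
  next
    case False
    have ramp: "ramp a p q x = max 0 (q - q / p * (x - a))"
      using False assms by (simp add: ramp_right)
    have "(a, 0) \<in> epigraph_over_ray \<phi>"
      using assms by (auto simp: epigraph_over_ray_def)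
    moreover have "(x - a, y) \<in> corner p q"
    proof -
      have "0 \<le> y" "q - q / p * (x - a) \<le> y"
        using y ramp zero[of x] False by auto
      then show ?thesis
        using False \<open>0 < p\<close> by (simp add: corner_def field_simps)
    qed
    ultimately have "(a, 0) + (x - a, y) \<in> epigraph_over_ray \<phi> + corner p q" by (rule set_plus_intro)
    then show ?thesis using z by simp
  qed
qed

text \<open>
  The quadrant makes the empty sum the polyhedron with covolume \<open>0\<close> instead of a single point; it
  is absorbed as soon as one corner is present, and by \<open>quadrant_plus_quadrant\<close> it does not disturb
  the addition of two such sums.
\<close>

definition corner_sum :: "('i \<Rightarrow> real) \<Rightarrow> ('i \<Rightarrow> real) \<Rightarrow> 'i set \<Rightarrow> (real \<times> real) set" where
  "corner_sum p q I = quadrant + (\<Sum>k\<in>I. corner (p k) (q k))"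

lemma quadrant_plus_quadrant: "quadrant + quadrant = quadrant"
proof
  show "quadrant + quadrant \<subseteq> quadrant" by (auto simp: set_plus_def quadrant_def)
  show "quadrant \<subseteq> quadrant + quadrant" by (rule set_zero_plus2) (simp add: quadrant_def zero_prod_def)
qed

text \<open>
  The boundary is built by inserting the edges in the order of decreasing steepness \<open>q k / p k\<close>. At
  every stage the new edge is the flattest one, so \<open>epigraph_plus_corner\<close> applies; the statement
  about the slopes \<open>c\<close> is the invariant that keeps it applicable. The insertion of \<open>l\<close> increases the
  area by \<open>q l\<close> times the total width so far plus half of \<open>p l * q l\<close>. Since \<open>l\<close> is flattest,
  \<open>p k * q l\<close> is the minimum of \<open>p k * q l\<close> and \<open>p l * q k\<close>, which makes the total independent of the
  order of the edges.
\<close>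

lemma corner_sum_boundary:
  fixes p q :: "'i \<Rightarrow> real"
  assumes "finite I" and "\<forall>k\<in>I. 0 < p k \<and> 0 < q k"
  shows "\<exists>\<phi>. \<phi> \<in> borel_measurable borel \<and> (\<forall>x\<ge>0. 0 \<le> \<phi> x) \<and> (\<forall>x\<ge>sum p I. \<phi> x = 0)
    \<and> (\<forall>c. (\<forall>k\<in>I. c \<le> q k / p k) \<longrightarrow>
         (\<forall>x y. 0 \<le> x \<longrightarrow> x \<le> y \<longrightarrow> y \<le> sum p I \<longrightarrow> c * (y - x) \<le> \<phi> x - \<phi> y))
    \<and> corner_sum p q I = epigraph_over_ray \<phi>
    \<and> (\<integral>\<^sup>+x. ennreal (\<phi> x) * indicator {0..} x \<partial>lborel)
        = ennreal ((\<Sum>k\<in>I. \<Sum>l\<in>I. min (p k * q l) (p l * q k)) / 2)"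
  using assms
proof (induction I rule: finite_ranking_induct[where f = "\<lambda>k. p k / q k"])
  case empty
  have "c * (y - x) \<le> 0" if "0 \<le> x" "x \<le> y" "y \<le> 0" for c x y :: real
  proof -
    have "x = 0" "y = 0" using that by auto
    then show ?thesis by simp
  qed
  moreover have "corner_sum p q {} = epigraph_over_ray (\<lambda>_. 0)"
    by (auto simp: corner_sum_def quadrant_def epigraph_over_ray_def)
  ultimately show ?case
    by (intro exI[of _ "\<lambda>_. 0"]) simp
next
  case (insert l I)
  show ?case
  proof (cases "l \<in> I")
    case True
    then show ?thesis using insert by (simp add: insert_absorb)
  next
    case False
    define a where "a = sum p I"
    have pos: "0 < p k" "0 < q k" if "k \<in> insert l I" for k using insert.prems that by auto
    have "0 \<le> a" unfolding a_def by (intro sum_nonneg) (use pos in \<open>force simp: less_imp_le\<close>)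
    have sum_a: "sum p (insert l I) = a + p l" using insert False by (simp add: a_def)
    have slope: "q l / p l \<le> q k / p k" if "k \<in> I" for k
      using insert.hyps(2)[OF that] pos[of k] pos[of l] that by (simp add: field_simps)
    have "\<forall>k\<in>I. 0 < p k \<and> 0 < q k" using insert.prems by simp
    note IH = insert.IH[OF this, folded a_def]
    obtain \<phi> where [measurable]: "\<phi> \<in> borel_measurable borel"
      and nonneg: "\<And>x. 0 \<le> x \<Longrightarrow> 0 \<le> \<phi> x" and zero: "\<And>x. a \<le> x \<Longrightarrow> \<phi> x = 0"
      and steep_all: "\<forall>c. (\<forall>k\<in>I. c \<le> q k / p k) \<longrightarrow>
         (\<forall>x y. 0 \<le> x \<longrightarrow> x \<le> y \<longrightarrow> y \<le> a \<longrightarrow> c * (y - x) \<le> \<phi> x - \<phi> y)"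
      and epi: "corner_sum p q I = epigraph_over_ray \<phi>"
      and int: "(\<integral>\<^sup>+x. ennreal (\<phi> x) * indicator {0..} x \<partial>lborel)
        = ennreal ((\<Sum>k\<in>I. \<Sum>l\<in>I. min (p k * q l) (p l * q k)) / 2)"
      using IH by (elim exE conjE) (rule that, auto)
    have steep: "c * (y - x) \<le> \<phi> x - \<phi> y"
      if "\<And>k. k \<in> I \<Longrightarrow> c \<le> q k / p k" "0 \<le> x" "x \<le> y" "y \<le> a" for c x y
      using steep_all that by blast
    define \<psi> where "\<psi> x = \<phi> x + ramp a (p l) (q l) x" for x
    have pl: "0 < p l" "0 < q l" using pos by auto
    have [measurable]: "ramp a (p l) (q l) \<in> borel_measurable borel"
      unfolding ramp_def by measurable
    have 1: "\<psi> \<in> borel_measurable borel" unfolding \<psi>_def by measurable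
    have 2: "\<forall>x\<ge>0. 0 \<le> \<psi> x" using nonneg ramp_nonneg by (simp add: \<psi>_def)
    have 3: "\<forall>x\<ge>sum p (insert l I). \<psi> x = 0"
      using zero pl by (auto simp: \<psi>_def sum_a ramp_beyond)
    have 4: "c * (y - x) \<le> \<psi> x - \<psi> y"
      if c: "\<forall>k\<in>insert l I. c \<le> q k / p k" and xy: "0 \<le> x" "x \<le> y" "y \<le> sum p (insert l I)" for c x y
    proof -
      \<comment> \<open>The boundary is steep before the foot \<open>a\<close> by induction, and has the slope of the new edge after it.\<close>
      have left: "c * (y - x) \<le> \<psi> x - \<psi> y" if "0 \<le> x" "x \<le> y" "y \<le> a" for x y
      proof -
        have "ramp a (p l) (q l) x = q l" "ramp a (p l) (q l) y = q l"
          using that pl by (simp_all add: ramp_left)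
        then show ?thesis using steep[of c x y] c that by (simp add: \<psi>_def)
      qed
      have right: "c * (y - x) \<le> \<psi> x - \<psi> y" if "a \<le> x" "x \<le> y" "y \<le> a + p l" for x y
      proof -
        have *: "\<psi> t = q l - q l / p l * (t - a)" if "a \<le> t" "t \<le> a + p l" for t
          using that pl zero by (simp add: \<psi>_def ramp_edge)
        have "\<psi> x - \<psi> y = q l / p l * (y - x)"
          using that pl by (simp add: * field_simps)
        moreover have "c * (y - x) \<le> q l / p l * (y - x)"
          using c that by (intro mult_right_mono) auto
        ultimately show ?thesis by simp
      qed
      consider "y \<le> a" | "a \<le> x" | "x \<le> a" "a \<le> y" by linarith
      then show ?thesis
      proof cases
        case 1
        then show ?thesis by (intro left xy)
      next
        case 2
        then show ?thesis using xy sum_a by (intro right) auto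
      next
        case 3
        have "c * (a - x) \<le> \<psi> x - \<psi> a" "c * (y - a) \<le> \<psi> a - \<psi> y"
          using left[of x a] right[of a y] 3 xy sum_a pl \<open>0 \<le> a\<close> by auto
        then show ?thesis by (simp add: algebra_simps)
      qed
    qed
    have "corner_sum p q (insert l I) = corner_sum p q I + corner (p l) (q l)"
      using False insert.hyps by (simp add: corner_sum_def ac_simps)
    also have "\<dots> = epigraph_over_ray \<psi>"
      unfolding epi \<psi>_def
    proof (rule epigraph_plus_corner)
      show "q l / p l * (y - x) \<le> \<phi> x - \<phi> y" if "0 \<le> x" "x \<le> y" "y \<le> a" for x y
        using slope that by (rule steep)
    qed (fact pl \<open>0 \<le> a\<close> nonneg zero)+
    finally have 5: "corner_sum p q (insert l I) = epigraph_over_ray \<psi>" .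
    have min_eq: "min (p k * q l) (p l * q k) = p k * q l" "min (p l * q k) (p k * q l) = p k * q l"
      if "k \<in> I" for k
    proof -
      have "p k * q l \<le> p l * q k"
        using insert.hyps(2)[OF that] pos[of k] pl that by (simp add: field_simps)
      then show "min (p k * q l) (p l * q k) = p k * q l" "min (p l * q k) (p k * q l) = p k * q l"
        by (simp_all add: min_def)
    qed
    have total: "(\<Sum>k\<in>insert l I. \<Sum>j\<in>insert l I. min (p k * q j) (p j * q k)) / 2
        = (\<Sum>k\<in>I. \<Sum>j\<in>I. min (p k * q j) (p j * q k)) / 2 + q l * (a + p l / 2)"
      using False insert.hyps
      by (simp add: min_eq sum.distrib a_def sum_distrib_left sum_distrib_right field_simps)
    have total_nonneg: "0 \<le> (\<Sum>k\<in>I. \<Sum>j\<in>I. min (p k * q j) (p j * q k)) / 2"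
      using pos by (intro divide_nonneg_nonneg sum_nonneg) (auto intro!: mult_nonneg_nonneg less_imp_le)
    have "(\<integral>\<^sup>+x. ennreal (\<psi> x) * indicator {0..} x \<partial>lborel) =
       (\<integral>\<^sup>+x. ennreal (\<phi> x) * indicator {0..} x + ennreal (ramp a (p l) (q l) x) * indicator {0..} x \<partial>lborel)"
      using nonneg ramp_nonneg
      by (intro nn_integral_cong) (auto simp: \<psi>_def indicator_def)
    also have "\<dots> = (\<integral>\<^sup>+x. ennreal (\<phi> x) * indicator {0..} x \<partial>lborel)
        + (\<integral>\<^sup>+x. ennreal (ramp a (p l) (q l) x) * indicator {0..} x \<partial>lborel)"
      by (intro nn_integral_add) auto
    also have "\<dots> = ennreal ((\<Sum>k\<in>I. \<Sum>j\<in>I. min (p k * q j) (p j * q k)) / 2 + q l * (a + p l / 2))"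
      unfolding int nn_integral_ramp[OF \<open>0 \<le> a\<close> pl]
      using pl \<open>0 \<le> a\<close> total_nonneg by (intro ennreal_plus[symmetric]) auto
    also note total[symmetric]
    finally have 6: "(\<integral>\<^sup>+x. ennreal (\<psi> x) * indicator {0..} x \<partial>lborel)
        = ennreal ((\<Sum>k\<in>insert l I. \<Sum>j\<in>insert l I. min (p k * q j) (p j * q k)) / 2)" .
    from 4 have 4: "\<forall>c. (\<forall>k\<in>insert l I. c \<le> q k / p k) \<longrightarrow>
         (\<forall>x y. 0 \<le> x \<longrightarrow> x \<le> y \<longrightarrow> y \<le> sum p (insert l I) \<longrightarrow> c * (y - x) \<le> \<psi> x - \<psi> y)"
      by blast
    show ?thesis by (rule exI[of _ \<psi>]) (intro conjI 1 2 3 4 5 6)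
  qed
qed

lemma covol_corner_sum:
  fixes p q :: "'i \<Rightarrow> real"
  assumes "finite I" and pos: "\<And>k. k \<in> I \<Longrightarrow> 0 < p k \<and> 0 < q k"
  shows "covol (corner_sum p q I) = (\<Sum>k\<in>I. \<Sum>l\<in>I. min (p k * q l) (p l * q k)) / 2"
proof -
  have "0 \<le> (\<Sum>k\<in>I. \<Sum>l\<in>I. min (p k * q l) (p l * q k)) / 2"
    using pos by (intro divide_nonneg_nonneg sum_nonneg) (auto intro!: mult_nonneg_nonneg less_imp_le)
  moreover have pos': "\<forall>k\<in>I. 0 < p k \<and> 0 < q k" using pos by blast
  obtain \<phi> where "\<phi> \<in> borel_measurable borel" "\<And>x. 0 \<le> x \<Longrightarrow> 0 \<le> \<phi> x"
      "corner_sum p q I = epigraph_over_ray \<phi>"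
      "(\<integral>\<^sup>+x. ennreal (\<phi> x) * indicator {0..} x \<partial>lborel)
        = ennreal ((\<Sum>k\<in>I. \<Sum>l\<in>I. min (p k * q l) (p l * q k)) / 2)"
    using corner_sum_boundary[OF \<open>finite I\<close> pos'] by (elim exE conjE) (rule that, auto)
  ultimately show ?thesis
    using covol_epigraph_over_ray by simp
qed

text \<open>
  The sum of the two polyhedra is again a sum of corners, over the disjoint union of the index
  sets. The covolume is half of a double sum over all pairs of edges, so subtracting the pairs from
  \<open>I\<close> and the pairs from \<open>J\<close> leaves each mixed pair counted twice, by symmetry.
\<close>

lemma mixed_covol_corner_sums:
  fixes p q :: "'i \<Rightarrow> real" and p' q' :: "'j \<Rightarrow> real"
  assumes "finite I" "finite J"
    and "\<And>k. k \<in> I \<Longrightarrow> 0 < p k \<and> 0 < q k" and "\<And>i. i \<in> J \<Longrightarrow> 0 < p' i \<and> 0 < q' i"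
  shows "mixed_covol (corner_sum p q I) (corner_sum p' q' J)
    = (\<Sum>k\<in>I. \<Sum>i\<in>J. min (p k * q' i) (p' i * q k))"
proof -
  define P where "P = case_sum p p'"
  define Q where "Q = case_sum q q'"
  have "corner_sum p q I + corner_sum p' q' J
     = (quadrant + quadrant) + ((\<Sum>k\<in>I. corner (p k) (q k)) + (\<Sum>i\<in>J. corner (p' i) (q' i)))"
    by (simp add: corner_sum_def ac_simps)
  also have "\<dots> = corner_sum P Q (I <+> J)"
    using assms by (simp add: corner_sum_def quadrant_plus_quadrant sum.Plus P_def Q_def comp_def)
  finally have sum: "corner_sum p q I + corner_sum p' q' J = corner_sum P Q (I <+> J)" .
  have pos: "0 < P k \<and> 0 < Q k" if "k \<in> I <+> J" for k
    using that assms by (auto simp: P_def Q_def)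
  have swap: "(\<Sum>i\<in>J. \<Sum>k\<in>I. min (p' i * q k) (p k * q' i)) = (\<Sum>k\<in>I. \<Sum>i\<in>J. min (p k * q' i) (p' i * q k))"
    by (subst sum.swap) (simp add: min.commute)
  have "covol (corner_sum P Q (I <+> J)) = 
    ((\<Sum>k\<in>I. \<Sum>l\<in>I. min (p k * q l) (p l * q k)) + (\<Sum>k\<in>I. \<Sum>i\<in>J. min (p k * q' i) (p' i * q k))
    + ((\<Sum>i\<in>J. \<Sum>k\<in>I. min (p' i * q k) (p k * q' i)) + (\<Sum>i\<in>J. \<Sum>j\<in>J. min (p' i * q' j) (p' j * q' i)))) / 2"
    using assms by (subst covol_corner_sum)
     (simp_all add: pos, simp add: sum.Plus P_def Q_def comp_def sum.distrib)
  then show ?thesis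
    using assms by (simp add: mixed_covol_def sum covol_corner_sum swap)
qed

section \<open>Newton polyhedra and their edges\<close>

abbreviation translated_quadrants :: "fps2 \<Rightarrow> (real \<times> real) set" where
  "translated_quadrants f \<equiv> (\<Union>(i, j) \<in> supp2 f. (\<lambda>z. (real i, real j) + z) ` quadrant)"

lemma translated_quadrantsE:
  assumes "z \<in> translated_quadrants f"
  obtains i j s t where "z = (real i + s, real j + t)" "(i, j) \<in> supp2 f" "0 \<le> s" "0 \<le> t"
  using assms by (auto simp: quadrant_def)

lemma supp2_in_translated_quadrants: "(i, j) \<in> supp2 f \<Longrightarrow> (real i, real j) \<in> translated_quadrants f"
  by (force simp: quadrant_def zero_prod_def)

lemma convex_newton_polyhedron: "convex (newton_polyhedron f)"
  by (simp add: newton_polyhedron_def)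

lemma convex_quadrant: "convex quadrant"
  by (auto simp: quadrant_def convex_def)

lemma newton_polyhedron_subset_quadrant: "newton_polyhedron f \<subseteq> quadrant"
  unfolding newton_polyhedron_def
proof (rule hull_minimal)
  show "translated_quadrants f \<subseteq> quadrant" by (auto simp: quadrant_def)
qed (rule convex_quadrant)

lemma newton_polyhedron_plus_quadrant: "newton_polyhedron f + quadrant \<subseteq> newton_polyhedron f"
proof
  fix z assume "z \<in> newton_polyhedron f + quadrant"
  then obtain u w where z: "z = u + w" and u: "u \<in> newton_polyhedron f" and w: "w \<in> quadrant"
    by (rule set_plus_elim)
  have "(+) w ` translated_quadrants f \<subseteq> translated_quadrants f"
  proof (rule image_subsetI)
    fix x assume "x \<in> translated_quadrants f"
    then obtain i j s t where "x = (real i + s, real j + t)" "(i, j) \<in> supp2 f" "0 \<le> s" "0 \<le> t"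
      by (rule translated_quadrantsE)
    moreover obtain w1 w2 where "w = (w1, w2)" "0 \<le> w1" "0 \<le> w2" using w by (auto simp: quadrant_def)
    ultimately show "w + x \<in> translated_quadrants f"
      by (auto simp: quadrant_def intro!: bexI[of _ "(i, j)"] image_eqI[of _ _ "(w1 + s, w2 + t)"])
  qed
  then have "convex hull ((+) w ` translated_quadrants f) \<subseteq> newton_polyhedron f"
    unfolding newton_polyhedron_def by (rule hull_mono)
  then show "z \<in> newton_polyhedron f"
    using u z unfolding newton_polyhedron_def convex_hull_translation by (auto simp: add.commute)
qed

text \<open>
  A convex combination that attains the minimum of a linear function can only involve points that
  attain it. Equivalently, the open half-space together with the hull of the minimal points is
  convex and contains \<open>S\<close>.
\<close>

lemma convex_hull_Int_supporting_line:
  fixes S :: "'a::real_inner set"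
  assumes "\<And>x. x \<in> S \<Longrightarrow> b \<le> a \<bullet> x"
  shows "convex hull S \<inter> {x. a \<bullet> x = b} = convex hull (S \<inter> {x. a \<bullet> x = b})"
proof
  let ?L = "{x. a \<bullet> x = b}" and ?C = "convex hull (S \<inter> {x. a \<bullet> x = b})"
  have C: "?C \<subseteq> ?L" by (rule hull_minimal) (auto simp: convex_hyperplane)
  have "convex ({x. b < a \<bullet> x} \<union> ?C)"
  proof (rule convexI)
    fix x y and u v :: real
    assume x: "x \<in> {x. b < a \<bullet> x} \<union> ?C" and y: "y \<in> {x. b < a \<bullet> x} \<union> ?C"
      and uv: "0 \<le> u" "0 \<le> v" "u + v = 1"
    have ge: "b \<le> a \<bullet> x" "b \<le> a \<bullet> y" using x y C by auto
    have b: "b = u * b + v * b" using uv by (simp add: distrib_right[symmetric])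
    have eq: "a \<bullet> (u *\<^sub>R x + v *\<^sub>R y) = u * (a \<bullet> x) + v * (a \<bullet> y)"
      by (simp add: inner_add_right)
    consider "u = 0" | "v = 0" | "0 < u" "0 < v" using uv by linarith
    then show "u *\<^sub>R x + v *\<^sub>R y \<in> {x. b < a \<bullet> x} \<union> ?C"
    proof cases
      case 3
      show ?thesis
      proof (cases "x \<in> ?C \<and> y \<in> ?C")
        case True
        then show ?thesis using uv by (auto intro: convexD[OF convex_convex_hull])
      next
        case False
        then have "b < a \<bullet> x \<or> b < a \<bullet> y" using x y by auto
        then have "u * b + v * b < u * (a \<bullet> x) + v * (a \<bullet> y)"
          using ge 3 by (auto intro: add_less_le_mono add_le_less_mono)
        then show ?thesis using b eq by simp
      qed
    qed (use x y uv in auto)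
  qed
  moreover have "S \<subseteq> {x. b < a \<bullet> x} \<union> ?C"
    using assms by (force intro: hull_inc)
  ultimately have "convex hull S \<subseteq> {x. b < a \<bullet> x} \<union> ?C" by (rule hull_minimal[rotated])
  then show "convex hull S \<inter> ?L \<subseteq> ?C" by auto
  show "?C \<subseteq> convex hull S \<inter> ?L"
    using C hull_mono[of "S \<inter> ?L" S] by auto
qed

lemma newton_diagram_subset: "newton_diagram f \<subseteq> newton_polyhedron f"
  by (auto simp: newton_diagram_def dest: face_of_imp_subset)

text \<open>
  The part of the polyhedron on a coordinate axis is the hull of the generating points on that
  axis, so if it is nonempty, then so is the support on the axis.
\<close>

lemma convenient_supp2:
  assumes "convenient f"
  obtains i j where "(i, 0) \<in> supp2 f" "(0, j) \<in> supp2 f"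
proof -
  have point: "\<exists>z \<in> translated_quadrants f. a \<bullet> z = 0"
    if "a \<in> quadrant" "z \<in> newton_diagram f" "a \<bullet> z = 0" for a z
  proof -
    have "0 \<le> a \<bullet> x" if "x \<in> translated_quadrants f" for x
      using that \<open>a \<in> quadrant\<close> by (auto elim!: translated_quadrantsE simp: quadrant_def)
    then have "newton_polyhedron f \<inter> {x. a \<bullet> x = 0} = convex hull (translated_quadrants f \<inter> {x. a \<bullet> x = 0})"
      unfolding newton_polyhedron_def by (rule convex_hull_Int_supporting_line)
    moreover have "z \<in> newton_polyhedron f \<inter> {x. a \<bullet> x = 0}"
      using that newton_diagram_subset by auto
    ultimately have "translated_quadrants f \<inter> {x. a \<bullet> x = 0} \<noteq> {}" by (metis convex_hull_empty empty_iff)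
    then show ?thesis by blast
  qed
  have axes: "(1, 0) \<in> quadrant" "(0, 1) \<in> quadrant" by (auto simp: quadrant_def)
  obtain z w where "z \<in> newton_diagram f" "fst z = 0" "w \<in> newton_diagram f" "snd w = 0"
    using assms by (auto simp: convenient_def)
  then have "(1, 0) \<bullet> z = 0" "(0, 1) \<bullet> w = 0" by (simp_all add: inner_prod_def)
  then obtain z' w' where z': "z' \<in> translated_quadrants f" "(1, 0) \<bullet> z' = 0"
      and w': "w' \<in> translated_quadrants f" "(0, 1) \<bullet> w' = 0"
    using point[OF axes(1) \<open>z \<in> _\<close>] point[OF axes(2) \<open>w \<in> _\<close>] by blast
  obtain j where "(0, j) \<in> supp2 f"
    using z'(1)
  proof (rule translated_quadrantsE)
    fix i j and s t :: real assume "z' = (real i + s, real j + t)" "(i, j) \<in> supp2 f" "0 \<le> s"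
    moreover from this z'(2) have "i = 0" by (auto simp: add_nonneg_eq_0_iff)
    ultimately show thesis using that by blast
  qed
  moreover obtain i where "(i, 0) \<in> supp2 f"
    using w'(1)
  proof (rule translated_quadrantsE)
    fix i j and s t :: real assume "w' = (real i + s, real j + t)" "(i, j) \<in> supp2 f" "0 \<le> t"
    moreover from this w'(2) have "j = 0" by (auto simp: add_nonneg_eq_0_iff)
    ultimately show thesis using that by blast
  qed
  ultimately show ?thesis using that by blast
qed

text \<open>
  Among the lines through \<open>(0, b)\<close> and a support point strictly below it, the steepest descending
  one passes below the whole support. It joins \<open>(0, b)\<close> to a point \<open>(m, n)\<close> that minimises
  \<open>m / (b - n)\<close>; the minimum exists because only the finitely many points with \<open>i \<le> i0\<close>
  compete with \<open>(i0, 0)\<close>.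
\<close>

lemma supporting_line_through_lowest_support_point:
  assumes "(i0, 0) \<in> supp2 f" "(0, b) \<in> supp2 f" "0 < i0" "0 < b"
    and least: "\<And>j. (0, j) \<in> supp2 f \<Longrightarrow> b \<le> j"
  obtains m n where "(m, n) \<in> supp2 f" "0 < m" "n < b"
    "\<And>i j. (i, j) \<in> supp2 f \<Longrightarrow> real m * b \<le> real (b - n) * i + real m * j"
proof -
  define W where "W = {(i, j) \<in> supp2 f. j < b \<and> i \<le> i0}"
  have "finite W" by (rule finite_subset[of _ "{..i0} \<times> {..<b}"]) (auto simp: W_def)
  moreover have W0: "(i0, 0) \<in> W" using assms by (simp add: W_def)
  ultimately have "finite ((\<lambda>(i, j). real i / real (b - j)) ` W)" "(\<lambda>(i, j). real i / real (b - j)) ` W \<noteq> {}"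
    by auto
  from Min_in[OF this] obtain m n where mn: "(m, n) \<in> W"
    and min: "real m / real (b - n) = Min ((\<lambda>(i, j). real i / real (b - j)) ` W)" by auto
  have "n < b" "(m, n) \<in> supp2 f" using mn by (auto simp: W_def)
  moreover have "0 < m" using least[of n] \<open>n < b\<close> \<open>(m, n) \<in> supp2 f\<close> by (cases m) auto
  moreover have "real m * b \<le> real (b - n) * i + real m * j" if ij: "(i, j) \<in> supp2 f" for i j
  proof -
    have W: "real m * (real b - real j) \<le> real (b - n) * i" if "(i, j) \<in> W" for i j
    proof -
      have "real m / real (b - n) \<le> real i / real (b - j)" "j < b"
        using that \<open>finite W\<close> unfolding min by (auto simp: W_def intro!: Min_le image_eqI[of _ _ "(i, j)"])
      then show ?thesis using \<open>n < b\<close> by (simp add: field_simps)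
    qed
    consider "b \<le> j" | "j < b" "i \<le> i0" | "i0 < i" by linarith
    then show ?thesis
    proof cases
      case 1
      then have "real m * b \<le> real m * j" by (simp add: mult_left_mono)
      moreover have "0 \<le> real (b - n) * i" by simp
      ultimately show ?thesis by linarith
    next
      case 2
      then show ?thesis using W[of i j] ij by (simp add: W_def right_diff_distrib)
    next
      case 3
      then have "real (b - n) * i0 \<le> real (b - n) * i" by (simp add: mult_left_mono)
      moreover have "0 \<le> real m * j" by simp
      moreover have "real m * b \<le> real (b - n) * i0" using W[OF W0] by simp
      ultimately show ?thesis by linarith
    qed
  qed
  ultimately show ?thesis using that by blast
qed

text \<open>
  The steepest line of the previous lemma meets the polyhedron in an edge. It has a strictly
  positive normal vector, so it carries only finitely many generating points, and the edge is their
  convex hull. The lemma excludes an empty list of edge vectors, for which the vertices of the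
  diagram would not be tied to the polyhedron at all.
\<close>

lemma newton_polyhedron_has_compact_edge:
  assumes "convenient f" and "coeff2 f 0 0 = 0"
  shows "\<exists>E. E edge_of newton_polyhedron f \<and> compact E"
proof -
  obtain i0 j0 where i0: "(i0, 0) \<in> supp2 f" and j0: "(0, j0) \<in> supp2 f"
    using assms(1) by (rule convenient_supp2)
  define b where "b = (LEAST j. (0, j) \<in> supp2 f)"
  have b: "(0, b) \<in> supp2 f" unfolding b_def using j0 by (rule LeastI)
  have least: "b \<le> j" if "(0, j) \<in> supp2 f" for j unfolding b_def using that by (rule Least_le)
  have "(0, 0) \<notin> supp2 f" using assms(2) by (simp add: supp2_def)
  then have "0 < i0" "0 < b" using i0 b by (auto intro!: gr0I)
  obtain m n where mn: "(m, n) \<in> supp2 f" "0 < m" "n < b"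
    and supp: "\<And>i j. (i, j) \<in> supp2 f \<Longrightarrow> real m * b \<le> real (b - n) * i + real m * j"
    using supporting_line_through_lowest_support_point[OF i0 b \<open>0 < i0\<close> \<open>0 < b\<close> least] by blast
  define a c where "a = (real (b - n), real m)" and "c = real m * b"
  define L where "L = {z. a \<bullet> z = c}"
  have pos: "0 < real (b - n)" "0 < real m" using mn by auto
  have ge: "c \<le> a \<bullet> z" if "z \<in> translated_quadrants f" for z
    using that
  proof (rule translated_quadrantsE)
    fix i j s t assume z: "z = (real i + s, real j + t)" "(i, j) \<in> supp2 f" "0 \<le> s" "0 \<le> t"
    then have "0 \<le> real (b - n) * s" "0 \<le> real m * t" by (auto intro: mult_nonneg_nonneg)
    then show ?thesis using supp[OF z(2)] by (simp add: z(1) a_def c_def distrib_left)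
  qed
  have E: "newton_polyhedron f \<inter> L = convex hull (translated_quadrants f \<inter> L)"
    unfolding newton_polyhedron_def L_def using ge by (rule convex_hull_Int_supporting_line)
  have "translated_quadrants f \<inter> L \<subseteq> (\<lambda>(i, j). (real i, real j)) ` ({..m * b} \<times> {..b})"
  proof
    fix z assume "z \<in> translated_quadrants f \<inter> L"
    then have "z \<in> translated_quadrants f" "z \<in> L" by auto
    then obtain i j s t where z: "z = (real i + s, real j + t)" "(i, j) \<in> supp2 f" "0 \<le> s" "0 \<le> t"
      by (elim translated_quadrantsE)
    then have "real (b - n) * (i + s) + real m * (j + t) = real m * b"
      using \<open>z \<in> L\<close> by (simp add: L_def a_def c_def)
    then have "real (b - n) * i + real (b - n) * s + (real m * j + real m * t) = real m * b"
      by (simp only: distrib_left)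
    moreover have "0 \<le> real (b - n) * s" "0 \<le> real m * t" using z by simp_all
    ultimately have "real (b - n) * s = 0" "real m * t = 0" and eq: "real (b - n) * i + real m * j = real m * b"
      using supp[OF z(2)] by linarith+
    then have "s = 0" "t = 0" using pos by auto
    from eq have "real ((b - n) * i + m * j) = real (m * b)" by simp
    then have eq: "(b - n) * i + m * j = m * b" by (simp only: of_nat_eq_iff)
    have "1 * i \<le> (b - n) * i" using mn by (intro mult_le_mono1) simp
    then have "i \<le> m * b" using eq by linarith
    moreover have "m * j \<le> m * b" using eq by linarith
    then have "j \<le> b" using mn by simp
    ultimately show "z \<in> (\<lambda>(i, j). (real i, real j)) ` ({..m * b} \<times> {..b})"
      using z \<open>s = 0\<close> \<open>t = 0\<close> by auto
  qed
  then have "finite (translated_quadrants f \<inter> L)" by (rule finite_subset) simp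
  then have "compact (newton_polyhedron f \<inter> L)"
    unfolding E by (intro finite_imp_compact_convex_hull)
  moreover have "(newton_polyhedron f \<inter> L) face_of newton_polyhedron f"
    unfolding L_def
  proof (rule face_of_Int_supporting_hyperplane_ge[OF convex_newton_polyhedron])
    fix z assume "z \<in> newton_polyhedron f"
    moreover have "newton_polyhedron f \<subseteq> {z. c \<le> a \<bullet> z}"
      unfolding newton_polyhedron_def
      using ge by (intro hull_minimal convex_halfspace_ge) blast
    ultimately show "c \<le> a \<bullet> z" by auto
  qed
  moreover have "aff_dim (newton_polyhedron f \<inter> L) = 1"
  proof (rule antisym)
    have "aff_dim (newton_polyhedron f \<inter> L) \<le> aff_dim L" by (rule aff_dim_subset) simp
    also have "\<dots> = 1" using pos by (simp add: L_def a_def zero_prod_def)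
    finally show "aff_dim (newton_polyhedron f \<inter> L) \<le> 1" .
    have "(real 0, real b) \<in> translated_quadrants f \<inter> L"
      using supp2_in_translated_quadrants[OF b] by (simp add: L_def a_def c_def)
    moreover have "(real m, real n) \<in> translated_quadrants f \<inter> L"
      using supp2_in_translated_quadrants[OF mn(1)] mn(3)
      by (simp add: L_def a_def c_def of_nat_diff algebra_simps)
    ultimately have "{(real 0, real b), (real m, real n)} \<subseteq> newton_polyhedron f \<inter> L"
      unfolding E by (auto intro: hull_inc)
    then have "aff_dim {(real 0, real b), (real m, real n)} \<le> aff_dim (newton_polyhedron f \<inter> L)"
      by (rule aff_dim_subset)
    then show "1 \<le> aff_dim (newton_polyhedron f \<inter> L)" using mn by simp
  qed
  ultimately show ?thesis unfolding edge_of_def by blast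
qed

text \<open>
  A point \<open>z\<close> of \<open>P\<close> below the line of the segment would be an endpoint of a segment in \<open>P\<close> that
  passes through the midpoint of the face. Indeed, continuing slightly from \<open>z\<close> beyond the
  midpoint leads to a point vertically above the face, hence in \<open>P\<close>. By the definition of a face,
  \<open>z\<close> would then lie on the segment.
\<close>

lemma face_segment_supporting_line:
  fixes P :: "(real \<times> real) set"
  assumes face: "closed_segment (x0, y0) (x0 + p, y0 - q) face_of P"
    and up: "P + quadrant \<subseteq> P" and "0 < p" "0 < q" and z: "(x, y) \<in> P"
  shows "q * x0 + p * y0 \<le> q * x + p * y"
proof (rule ccontr)
  assume neg: "\<not> ?thesis"
  define d where "d = (q * x0 + p * y0) - (q * x + p * y)"
  have "0 < d" using neg by (simp add: d_def)
  let ?S = "closed_segment (x0, y0) (x0 + p, y0 - q)"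
  have SP: "?S \<subseteq> P" using face by (rule face_of_imp_subset)
  have seg: "(x0 + t * p, y0 - t * q) \<in> ?S" if "0 \<le> t" "t \<le> 1" for t
    unfolding closed_segment_def using that by (auto intro!: exI[of _ t] simp: algebra_simps)
  define mx my where "mx = x0 + p / 2" and "my = y0 - q / 2"
  have m: "(mx, my) \<in> ?S" using seg[of "1/2"] by (simp add: mx_def my_def)
  have meq: "q * mx + p * my = q * x0 + p * y0" by (simp add: mx_def my_def algebra_simps)
  define c where "c = \<bar>mx - x\<bar> + p"
  define e where "e = p / (2 * c)"
  have "0 < c" using \<open>0 < p\<close> by (simp add: c_def add_nonneg_pos)
  then have "0 < e" using \<open>0 < p\<close> by (simp add: e_def)
  have "e * \<bar>mx - x\<bar> \<le> e * c"
    using \<open>0 < e\<close> \<open>0 < p\<close> by (intro mult_left_mono) (auto simp: c_def)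
  also have "\<dots> = p / 2"
    using \<open>0 < c\<close> by (simp add: e_def)
  finally have "e * \<bar>mx - x\<bar> \<le> p / 2" .
  then have "\<bar>e * (mx - x)\<bar> \<le> p / 2" using \<open>0 < e\<close> by (simp add: abs_mult)
  define h where "h = e * (mx - x)"
  \<comment> \<open>\<open>e\<close> is small enough for the prolongation to have its abscissa over the segment, at parameter \<open>t\<close>.\<close>
  define t where "t = 1 / 2 + h / p"
  have "0 \<le> t" "t \<le> 1"
    using \<open>\<bar>e * (mx - x)\<bar> \<le> p / 2\<close> \<open>0 < p\<close>
    unfolding h_def[symmetric] abs_le_iff by (simp_all add: t_def field_simps)
  \<comment> \<open>the vertical distance between the segment and the prolonged point\<close>
  define w where "w = e * d / p"
  have "0 \<le> w" using \<open>0 < e\<close> \<open>0 < d\<close> \<open>0 < p\<close> by (simp add: w_def)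
  have "(x0 + t * p, y0 - t * q) + (0, w) \<in> P + quadrant"
    using seg[OF \<open>0 \<le> t\<close> \<open>t \<le> 1\<close>] SP \<open>0 \<le> w\<close> by (intro set_plus_intro) (auto simp: quadrant_def)
  also have "(x0 + t * p, y0 - t * q) + (0, w) = (mx, my) + e *\<^sub>R ((mx, my) - (x, y))"
  proof -
    have tp: "t * p = p / 2 + h" using \<open>0 < p\<close> by (simp add: t_def field_simps)
    have pw: "p * w = e * d" using \<open>0 < p\<close> by (simp add: w_def)
    have "p * (y0 - t * q + w) = p * y0 - q * (t * p) + p * w" by (simp add: algebra_simps)
    also have "\<dots> = p * (my + e * (my - y))"
      unfolding tp pw by (simp add: h_def d_def mx_def my_def algebra_simps)
    finally have "y0 - t * q + w = my + e * (my - y)" using \<open>0 < p\<close> by simp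
    moreover have "x0 + t * p = mx + e * (mx - x)" by (simp add: tp h_def mx_def)
    ultimately show ?thesis by simp
  qed
  finally have u: "(mx, my) + e *\<^sub>R ((mx, my) - (x, y)) \<in> P" using up by blast
  let ?u = "(mx, my) + e *\<^sub>R ((mx, my) - (x, y))"
  define r where "r = 1 / (1 + e)"
  have "r + r * e = 1" using \<open>0 < e\<close> by (simp add: r_def field_simps)
  moreover have "(1 - r) * s + r * (n + e * (n - s)) = s * (1 - (r + r * e)) + n * (r + r * e)" for n s :: real
    by (simp add: algebra_simps)
  ultimately have "(mx, my) = (1 - r) *\<^sub>R (x, y) + r *\<^sub>R ?u"
    by simp
  moreover have "(x, y) \<noteq> ?u"
  proof
    assume "(x, y) = ?u"
    then have "(1 + e) * (mx - x) = 0" "(1 + e) * (my - y) = 0" by (simp_all add: algebra_simps)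
    then have "mx = x" "my = y" using \<open>0 < e\<close> by auto
    then show False using meq \<open>0 < d\<close> by (simp add: d_def)
  qed
  moreover have "0 < r" "r < 1" using \<open>0 < e\<close> by (auto simp: r_def)
  ultimately have "(mx, my) \<in> open_segment (x, y) ?u" unfolding in_segment by blast
  then have "(x, y) \<in> ?S" using face_ofD[OF face _ z u m] by blast
  then obtain t where "x = x0 + t * p" "y0 = y + t * q"
    unfolding closed_segment_def by (auto simp: algebra_simps)
  then have "d = 0" by (simp add: d_def algebra_simps)
  then show False using \<open>0 < d\<close> by simp
qed

section \<open>Convex chains as sums of corners\<close>

text \<open>
  The \<open>k\<close>-th vertex of the chain of edges \<open>(p 1, - q 1), \<dots>, (p r, - q r)\<close> that descends from the
  vertical to the horizontal axis is \<open>(chain_x p k, chain_y q r k)\<close>.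
\<close>

definition chain_x :: "(nat \<Rightarrow> real) \<Rightarrow> nat \<Rightarrow> real" where
  "chain_x p k = sum p {1..k}"

definition chain_y :: "(nat \<Rightarrow> real) \<Rightarrow> nat \<Rightarrow> nat \<Rightarrow> real" where
  "chain_y q r k = sum q {k<..r}"

lemma chain_x_simps [simp]: "chain_x p 0 = 0" "chain_x p (Suc k) = chain_x p k + p (Suc k)"
  by (simp_all add: chain_x_def)

lemma chain_y_end [simp]: "chain_y q r r = 0"
  by (simp add: chain_y_def)

lemma chain_y_step: "k < r \<Longrightarrow> chain_y q r k = q (Suc k) + chain_y q r (Suc k)"
proof -
  assume "k < r"
  then have "{k<..r} = insert (Suc k) {Suc k<..r}" by auto
  then show ?thesis by (simp add: chain_y_def)
qed

text \<open>
  The intersection of the quadrant with the half-planes above the lines that carry the edges. Edge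
  number \<open>Suc k\<close> starts at vertex \<open>k\<close>.
\<close>

definition above_chain :: "(nat \<Rightarrow> real) \<Rightarrow> (nat \<Rightarrow> real) \<Rightarrow> nat \<Rightarrow> (real \<times> real) set" where
  "above_chain p q r = {(x, y). 0 \<le> x \<and> 0 \<le> y \<and>
     (\<forall>k<r. q (Suc k) * chain_x p k + p (Suc k) * chain_y q r k \<le> q (Suc k) * x + p (Suc k) * y)}"

text \<open>
  A point of \<open>above_chain\<close> whose abscissa lies over some edge is vertically above a point of that
  edge; a point further right dominates the last vertex.
\<close>

lemma above_chain_subset:
  assumes "1 \<le> r" and pos: "\<And>k. k \<in> {1..r} \<Longrightarrow> 0 < p k \<and> 0 < q k"
    and up: "A + quadrant \<subseteq> A"
    and seg: "\<And>k t. k < r \<Longrightarrow> 0 \<le> t \<Longrightarrow> t \<le> 1 \<Longrightarrow>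
      (chain_x p k + t * p (Suc k), chain_y q r k - t * q (Suc k)) \<in> A"
  shows "above_chain p q r \<subseteq> A"
proof safe
  fix x y assume "(x, y) \<in> above_chain p q r"
  then have xy: "0 \<le> x" "0 \<le> y" and lines: "\<And>k. k < r \<Longrightarrow>
      q (Suc k) * chain_x p k + p (Suc k) * chain_y q r k \<le> q (Suc k) * x + p (Suc k) * y"
    by (auto simp: above_chain_def)
  obtain n where n: "r = Suc n" using \<open>1 \<le> r\<close> by (cases r) auto
  show "(x, y) \<in> A"
  proof (cases "x \<le> chain_x p r")
    case True
    \<comment> \<open>Edge \<open>Suc k\<close> lies over the abscissa \<open>x\<close>.\<close>
    define k where "k = (LEAST k. x \<le> chain_x p (Suc k))"
    have k: "x \<le> chain_x p (Suc k)"
      unfolding k_def by (rule LeastI[of _ n]) (use True n in simp)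
    have "k \<le> n" unfolding k_def by (rule Least_le) (use True n in simp)
    have "chain_x p k \<le> x"
    proof (cases k)
      case (Suc m)
      then have "\<not> x \<le> chain_x p (Suc m)"
        using not_less_Least[of m "\<lambda>k. x \<le> chain_x p (Suc k)"] unfolding k_def[symmetric] by simp
      then show ?thesis using Suc by simp
    qed (use xy in simp)
    have kr: "k < r" using \<open>k \<le> n\<close> n by simp
    have pq: "0 < p (Suc k)" "0 < q (Suc k)" using pos[of "Suc k"] kr by auto
    define t where "t = (x - chain_x p k) / p (Suc k)"
    have x: "x = chain_x p k + t * p (Suc k)" using pq by (simp add: t_def)
    have t: "0 \<le> t" "t \<le> 1" using \<open>chain_x p k \<le> x\<close> k pq by (simp_all add: t_def)
    define y' where "y' = chain_y q r k - t * q (Suc k)"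
    have "p (Suc k) * y' \<le> p (Suc k) * y"
      using lines[OF kr] unfolding x y'_def by (simp add: algebra_simps)
    then have "y' \<le> y" using pq by simp
    then have "(x, y') + (0, y - y') \<in> A + quadrant"
      using seg[OF kr t] x by (intro set_plus_intro) (auto simp: quadrant_def y'_def)
    then show ?thesis using up by auto
  next
    case False
    have "(chain_x p r, 0) \<in> A" using seg[of n 1] n chain_y_step[of n r q] by simp
    then have "(chain_x p r, 0) + (x - chain_x p r, y) \<in> A + quadrant"
      using False xy by (intro set_plus_intro) (auto simp: quadrant_def)
    then show ?thesis using up by auto
  qed
qed

lemma corner_sum_plus_quadrant: "corner_sum p q I + quadrant \<subseteq> corner_sum p q I"
proof -
  have "corner_sum p q I + quadrant = (quadrant + quadrant) + (\<Sum>k\<in>I. corner (p k) (q k))"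
    by (simp add: corner_sum_def ac_simps)
  then show ?thesis by (simp add: quadrant_plus_quadrant corner_sum_def)
qed

lemma corner_sum_memI:
  assumes "finite I" "\<And>k. k \<in> I \<Longrightarrow> (x k, y k) \<in> corner (p k) (q k)"
  shows "(sum x I, sum y I) \<in> corner_sum p q I"
proof -
  have "(\<Sum>k\<in>I. (x k, y k)) \<in> (\<Sum>k\<in>I. corner (p k) (q k))"
    using assms by (induction I rule: finite_induct) auto
  then have "(0, 0) + (\<Sum>k\<in>I. (x k, y k)) \<in> corner_sum p q I"
    unfolding corner_sum_def by (intro set_plus_intro) (auto simp: quadrant_def)
  then show ?thesis by (simp add: sum_prod zero_prod_def[symmetric])
qed

lemma corner_sum_memE:
  assumes "finite I" "(x, y) \<in> corner_sum p q I"
  obtains u v where "\<And>k. k \<in> I \<Longrightarrow> (u k, v k) \<in> corner (p k) (q k)" "sum u I \<le> x" "sum v I \<le> y"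
proof -
  obtain w z where w: "w \<in> quadrant" and z: "z \<in> (\<Sum>k\<in>I. corner (p k) (q k))" and "(x, y) = w + z"
    using assms(2) unfolding corner_sum_def by (rule set_plus_elim)
  moreover obtain c where "z = sum c I" and c: "\<And>k. k \<in> I \<Longrightarrow> c k \<in> corner (p k) (q k)"
    using z unfolding set_sum_alt[OF \<open>finite I\<close>] by blast
  ultimately have "sum (\<lambda>k. fst (c k)) I \<le> x" "sum (\<lambda>k. snd (c k)) I \<le> y"
    by (auto simp: quadrant_def prod_eq_iff fst_sum snd_sum)
  with c show ?thesis using that[of "\<lambda>k. fst (c k)" "\<lambda>k. snd (c k)"] by simp
qed

text \<open>
  A point on edge \<open>Suc k\<close> is the sum of the lower endpoints of the corners before it, of the upper
  endpoints of the corners after it, and of a point on the edge of its own corner.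
\<close>

lemma chain_segment_in_corner_sum:
  assumes pos: "\<And>k. k \<in> {1..r} \<Longrightarrow> 0 < p k \<and> 0 < q k" and "k < r" "0 \<le> t" "t \<le> 1"
  shows "(chain_x p k + t * p (Suc k), chain_y q r k - t * q (Suc k)) \<in> corner_sum p q {1..r}"
proof -
  define x where "x j = (if j \<le> k then p j else if j = Suc k then t * p j else 0)" for j
  define y where "y j = (if j \<le> k then 0 else if j = Suc k then (1 - t) * q j else q j)" for j
  have split: "{1..r} = {1..k} \<union> ({Suc k} \<union> {Suc k<..r})" using \<open>k < r\<close> by auto
  have "sum x {1..r} = sum x {1..k} + (x (Suc k) + sum x {Suc k<..r})"
    unfolding split by (subst sum.union_disjoint; auto)+
  also have "\<dots> = chain_x p k + t * p (Suc k)"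
    by (simp add: x_def chain_x_def)
  finally have x: "sum x {1..r} = chain_x p k + t * p (Suc k)" .
  have "sum y {1..r} = sum y {1..k} + (y (Suc k) + sum y {Suc k<..r})"
    unfolding split by (subst sum.union_disjoint; auto)+
  also have "\<dots> = (1 - t) * q (Suc k) + chain_y q r (Suc k)"
    by (simp add: y_def chain_y_def)
  also have "\<dots> = chain_y q r k - t * q (Suc k)"
    using chain_y_step[OF \<open>k < r\<close>, of q] by (simp add: algebra_simps)
  finally have y: "sum y {1..r} = chain_y q r k - t * q (Suc k)" .
  have "(x j, y j) \<in> corner (p j) (q j)" if "j \<in> {1..r}" for j
    using pos[OF that] \<open>0 \<le> t\<close> \<open>t \<le> 1\<close> by (auto simp: x_def y_def corner_def algebra_simps)
  then have "(sum x {1..r}, sum y {1..r}) \<in> corner_sum p q {1..r}"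
    by (intro corner_sum_memI) auto
  then show ?thesis unfolding x y .
qed

text \<open>
  A linear function with nonnegative coefficients is minimal on a corner at one of the two vertices
  \<open>(p, 0)\<close> and \<open>(0, q)\<close>.
\<close>

lemma linear_ge_on_corner:
  assumes "(x, y) \<in> corner p q" "0 < p" "0 < q" "0 \<le> m" "m \<le> a * p" "m \<le> b * q"
  shows "m \<le> a * x + b * y"
proof -
  have xy: "0 \<le> x" "0 \<le> y" "p * q \<le> q * x + p * y" using assms by (auto simp: corner_def)
  have "m * (p * q) \<le> m * (q * x + p * y)" using xy \<open>0 \<le> m\<close> by (intro mult_left_mono)
  also have "\<dots> = m * (q * x) + m * (p * y)" by (simp add: distrib_left)
  also have "\<dots> \<le> (a * p) * (q * x) + (b * q) * (p * y)"
    using assms xy by (intro add_mono mult_right_mono) auto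
  also have "\<dots> = (a * x + b * y) * (p * q)" by (simp add: algebra_simps)
  finally show ?thesis using assms by simp
qed

text \<open>
  The linear function normal to edge \<open>Suc k\<close> is minimised corner by corner. Because the slopes are
  sorted, its minimum is attained at \<open>(p j, 0)\<close> on the corners \<open>j \<le> k\<close> and at \<open>(0, q j)\<close> on the
  others, and these points add up to the vertex \<open>k\<close>.
\<close>

lemma corner_sum_subset_above_chain:
  assumes pos: "\<And>k. k \<in> {1..r} \<Longrightarrow> 0 < p k \<and> 0 < q k"
    and sorted: "\<And>k l. 1 \<le> k \<Longrightarrow> k \<le> l \<Longrightarrow> l \<le> r \<Longrightarrow> p k * q l \<le> p l * q k"
  shows "corner_sum p q {1..r} \<subseteq> above_chain p q r"
proof safe
  fix x y assume "(x, y) \<in> corner_sum p q {1..r}"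
  then obtain u v where uv: "\<And>j. j \<in> {1..r} \<Longrightarrow> (u j, v j) \<in> corner (p j) (q j)"
    and le: "sum u {1..r} \<le> x" "sum v {1..r} \<le> y"
    using corner_sum_memE[OF finite_atLeastAtMost] by metis
  have "0 \<le> sum u {1..r}" "0 \<le> sum v {1..r}"
    using uv by (auto intro!: sum_nonneg simp: corner_def)
  moreover have "q (Suc k) * chain_x p k + p (Suc k) * chain_y q r k \<le> q (Suc k) * x + p (Suc k) * y"
    if "k < r" for k
  proof -
    have k: "0 < p (Suc k)" "0 < q (Suc k)" using pos[of "Suc k"] \<open>k < r\<close> by auto
    define m where "m j = (if j \<le> k then q (Suc k) * p j else p (Suc k) * q j)" for j
    have "{1..r} = {1..k} \<union> {k<..r}" using \<open>k < r\<close> by auto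
    then have "sum m {1..r} = sum m {1..k} + sum m {k<..r}"
      by (simp only:) (rule sum.union_disjoint, auto)
    then have "q (Suc k) * chain_x p k + p (Suc k) * chain_y q r k = sum m {1..r}"
      by (simp add: m_def chain_x_def chain_y_def sum_distrib_left)
    also have "\<dots> \<le> (\<Sum>j\<in>{1..r}. q (Suc k) * u j + p (Suc k) * v j)"
    proof (rule sum_mono)
      fix j assume j: "j \<in> {1..r}"
      have "m j \<le> q (Suc k) * p j" "m j \<le> p (Suc k) * q j"
        using sorted[of j "Suc k"] sorted[of "Suc k" j] j \<open>k < r\<close> by (auto simp: m_def mult_ac)
      moreover have "0 \<le> m j" using pos[OF j] k by (simp add: m_def)
      ultimately show "m j \<le> q (Suc k) * u j + p (Suc k) * v j"
        using uv[OF j] pos[OF j] linear_ge_on_corner by blast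
    qed
    also have "\<dots> = q (Suc k) * sum u {1..r} + p (Suc k) * sum v {1..r}"
      by (simp add: sum.distrib sum_distrib_left)
    also have "\<dots> \<le> q (Suc k) * x + p (Suc k) * y"
      using le k by (intro add_mono mult_left_mono) auto
    finally show ?thesis .
  qed
  ultimately show "(x, y) \<in> above_chain p q r"
    using le by (auto simp: above_chain_def)
qed

text \<open>
  Each compact edge spans a supporting line of the polyhedron. Applied to the vertices of the chain
  itself this shows that the slopes are sorted, and applied to all points it puts the polyhedron
  inside \<open>above_chain\<close>. Both the polyhedron and the sum of corners contain the chain and are closed
  under adding the quadrant, so both contain \<open>above_chain\<close>, and all three sets agree.
\<close>

lemma newton_polyhedron_eq_corner_sum:
  assumes conv: "convenient f" "coeff2 f 0 0 = 0"
    and edges: "newton_edge_vectors f r (\<lambda>k. (p k, - q k))"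
    and pos: "\<And>k. k \<in> {1..r} \<Longrightarrow> 0 < p k \<and> 0 < q k"
  shows "newton_polyhedron f = corner_sum p q {1..r}"
proof -
  define P where "P = newton_polyhedron f"
  obtain v where v0: "fst (v 0) = 0" and vr: "snd (v r) = 0"
    and bij: "bij_betw (\<lambda>k. closed_segment (v (k - 1)) (v k)) {1..r} {E. E edge_of P \<and> compact E}"
    and e: "\<And>k. k \<in> {1..r} \<Longrightarrow> (p k, - q k) = v k - v (k - 1)"
    using edges unfolding newton_edge_vectors_def P_def by blast
  have "{E. E edge_of P \<and> compact E} \<noteq> {}"
    using newton_polyhedron_has_compact_edge[OF conv] by (auto simp: P_def)
  then have "1 \<le> r"
    using bij by (cases r) (auto simp: bij_betw_def)
  let ?X = "chain_x p" and ?Y = "chain_y q r"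
  have v_fst: "fst (v (Suc k)) = fst (v k) + p (Suc k)"
    and v_snd: "snd (v k) = q (Suc k) + snd (v (Suc k))" if "k < r" for k
    using e[of "Suc k"] that by (auto simp: prod_eq_iff)
  have v: "v k = (?X k, ?Y k)" if "k \<le> r" for k
  proof -
    have "fst (v k) = ?X k"
      using that by (induction k) (simp_all add: v0 v_fst)
    moreover from that have "snd (v k) = ?Y k"
      by (induction rule: inc_induct) (simp_all add: vr v_snd chain_y_step)
    ultimately show ?thesis by (simp add: prod_eq_iff)
  qed
  have face: "closed_segment (?X k, ?Y k) (?X k + p (Suc k), ?Y k - q (Suc k)) face_of P" if "k < r" for k
  proof -
    have "closed_segment (v (Suc k - 1)) (v (Suc k)) \<in> {E. E edge_of P \<and> compact E}"
      using that by (intro bij_betw_apply[OF bij]) auto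
    then show ?thesis using that by (simp add: edge_of_def v chain_y_step)
  qed
  have up: "P + quadrant \<subseteq> P" unfolding P_def by (rule newton_polyhedron_plus_quadrant)
  have line: "q (Suc k) * ?X k + p (Suc k) * ?Y k \<le> q (Suc k) * x + p (Suc k) * y"
    if "k < r" "(x, y) \<in> P" for k x y
    using face[OF that(1)] up _ _ that(2)
    by (rule face_segment_supporting_line) (use pos[of "Suc k"] that(1) in auto)
  have seg: "(?X k + t * p (Suc k), ?Y k - t * q (Suc k)) \<in> P" if "k < r" "0 \<le> t" "t \<le> 1" for k t
  proof -
    have "(?X k + t * p (Suc k), ?Y k - t * q (Suc k))
        \<in> closed_segment (?X k, ?Y k) (?X k + p (Suc k), ?Y k - q (Suc k))"
      unfolding closed_segment_def using that by (auto intro!: exI[of _ t] simp: algebra_simps)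
    then show ?thesis using face_of_imp_subset[OF face[OF that(1)]] by blast
  qed
  have sorted: "p k * q l \<le> p l * q k" if "1 \<le> k" "k \<le> l" "l \<le> r" for k l
  proof -
    have "q l / p l \<le> q k / p k"
      using that(2,1,3)
    proof (induction rule: dec_induct)
      case base
      then show ?case by simp
    next
      case (step n)
      obtain m where n: "n = Suc m" using step.hyps step.prems by (cases n) auto
      have mr: "m < r" "n < r" using step.prems n by auto
      \<comment> \<open>The vertex after edge \<open>Suc n\<close> lies above the line of edge \<open>n\<close>.\<close>
      have "q n * ?X m + p n * ?Y m \<le> q n * (?X n + p (Suc n)) + p n * (?Y n - q (Suc n))"
        using line[OF mr(1) seg[OF mr(2), of 1]] n by simp
      then have "p n * q (Suc n) \<le> q n * p (Suc n)"
        using chain_y_step[OF mr(1), of q] n by (simp add: algebra_simps)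
      then have "q (Suc n) / p (Suc n) \<le> q n / p n"
        using pos[of n] pos[of "Suc n"] step.hyps step.prems by (simp add: field_simps)
      then show ?case using step by simp
    qed
    then show ?thesis using pos[of k] pos[of l] that by (simp add: field_simps)
  qed
  have "P \<subseteq> above_chain p q r"
    using line newton_polyhedron_subset_quadrant[of f]
    by (auto simp: above_chain_def P_def quadrant_def)
  moreover have "above_chain p q r \<subseteq> P"
    using \<open>1 \<le> r\<close> pos up seg by (rule above_chain_subset)
  moreover have "above_chain p q r \<subseteq> corner_sum p q {1..r}"
    using \<open>1 \<le> r\<close> pos corner_sum_plus_quadrant chain_segment_in_corner_sum[OF pos]
    by (rule above_chain_subset)
  moreover have "corner_sum p q {1..r} \<subseteq> above_chain p q r"
    using pos sorted by (rule corner_sum_subset_above_chain)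
  ultimately show ?thesis unfolding P_def by blast
qed

theorem proposition7p2:
  fixes f g :: fps2
    and r s :: nat
    and p q p' q' :: "nat \<Rightarrow> real"
  assumes "convergent_fps2 f" and "convergent_fps2 g"
    and "coeff2 f 0 0 = 0" and "coeff2 g 0 0 = 0"
    and "convenient f" and "convenient g"
    and "newton_edge_vectors f r (\<lambda>k. (p k, - q k))"
    and "\<And>k. k \<in> {1..r} \<Longrightarrow> p k > 0 \<and> q k > 0"
    and "newton_edge_vectors g s (\<lambda>i. (p' i, - q' i))"
    and "\<And>i. i \<in> {1..s} \<Longrightarrow> p' i > 0 \<and> q' i > 0"
  shows "mixed_covol (newton_polyhedron f) (newton_polyhedron g) =
    (\<Sum>k=1..r. \<Sum>i=1..s. min (p k * q' i) (p' i * q k))"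
proof -
  have "newton_polyhedron f = corner_sum p q {1..r}"
    using assms(5,3,7,8) by (rule newton_polyhedron_eq_corner_sum)
  moreover have "newton_polyhedron g = corner_sum p' q' {1..s}"
    using assms(6,4,9,10) by (rule newton_polyhedron_eq_corner_sum)
  ultimately show ?thesis
    using mixed_covol_corner_sums[of "{1..r}" "{1..s}" p q p' q'] assms(8,10) by simp
qed

end
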